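(* For all $(p,0)\in\mathbf{N}$, $$\Lambda_{p,0}^* \stackrel{d}{=} 4\left(1+\cos\left(\frac{2\pi \mathcal{J}_{p,0}}{p} \right)\right) \mathcal{V}^2 - 4\sin\left(\frac{2\pi \mathcal{J}_{p,0}}{p}\right) \mathcal{V}\sqrt{1-\mathcal{V}^2} + 1 ,$$ and for all $(p,p)\in\mathbf{N}$, $$\Lambda_{p,p}^* \stackrel{d}{=} 4\mathcal{V}^2 + 4\cos\left(\frac{\pi \mathcal{J}_{p,p}}{p}\right) \mathcal{V} + 1,$$ where $\mathcal{V}$, $\mathcal{J}_{p,0}$, $\mathcal{J}_{p,p}$ are independent random variables, $\mathcal{J}_{p,0}$ is uniformly distributed on $\{0,\ldots,p-1\}$, $\mathcal{J}_{p,p}$ is uniformly distributed on $\{0,\ldots,2p-1\}$, and $\mathcal{V}$ has probability density function $$f_{\mathcal{V}}(x)=\frac{2}{\pi\sqrt{1-x^2}}\,\mathbf{1}\{0\le x<1\}.$$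
   Context: $\mathbb{N}_0=\{0,1,2,\ldots\}$ and $\mathbf{N}:=\{(p,q)\in\mathbb{N}_0^2 : p+q\ge 5,\ q\le p\}$. For such $(p,q)$, $\Lambda^*_{p,q}$ denotes the random eigenvalue of the dual infinite $(p,q)$-nanotube (the triangular lattice with a loop of weight $3$ at each vertex, rolled up along the chiral vector $(p,q)$), i.e. the real random variable with compactly supported distribution whose moments $\mu_k(\Lambda^*_{p,q})=\mathbb{E}(\Lambda^*_{p,q})^k$, $k\in\mathbb{N}_0$, are the (weighted) numbers of closed paths with $k$ steps from a vertex of this graph, given by $$\mu_k(\Lambda^*_{p,q})=\frac{1}{(2\pi)^3}\sum_{j\in\mathbb{Z}}\int_{-\pi}^{\pi}\int_{-\pi}^{\pi}\int_{-\pi}^{\pi}\left|e^{ix}+e^{iy}+e^{iz}\right|^{2k}e^{ij(p(x-z)+q(y-z))}\,dx\,dy\,dz .$$ For each fixed $k$ only finitely many terms of the sum are non-zero, and these moments determine the (compactly supported) distribution of $\Lambda^*_{p,q}$ uniquely. The symbol $\stackrel{d}{=}$ denotes equality in distribution. *)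

theory Defs
  imports "HOL-Probability.Probability"
begin

definition NN :: "(nat \<times> nat) set" where
  "NN = {(p, q). p + q \<ge> 5 \<and> q \<le> p}"

text \<open>
  The \<open>k\<close>-th moment of the random eigenvalue of the dual infinite \<open>(p, q)\<close>-nanotube, i.e. the
  weighted number of closed paths with \<open>k\<close> steps from a vertex of the triangular lattice
  (with a loop of weight 3 at each vertex) rolled up along the chiral vector \<open>(p, q)\<close>.
  For fixed \<open>k\<close> the integral vanishes for all but finitely many \<open>j\<close> if \<open>(p, q) \<noteq> (0, 0)\<close>,
  so that the infinite sum is in fact a finite one. It is stated in the complex numbers, since the
  individual integrands are complex.
\<close>

definition dual_nanotube_moment :: "nat \<Rightarrow> nat \<Rightarrow> nat \<Rightarrow> complex" where
  "dual_nanotube_moment p q k =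
     1 / (2 * of_real pi) ^ 3 *
     (\<Sum>\<^sub>\<infinity>j\<in>(UNIV :: int set).
        (LINT z:{-pi..pi}|lborel. (LINT y:{-pi..pi}|lborel. (LINT x:{-pi..pi}|lborel.
           complex_of_real (cmod (cis x + cis y + cis z) ^ (2 * k)) *
           cis (of_int j * (real p * (x - z) + real q * (y - z)))))))"

definition is_dual_nanotube_law :: "nat \<Rightarrow> nat \<Rightarrow> real measure \<Rightarrow> bool" where
  "is_dual_nanotube_law p q \<mu> \<longleftrightarrow>
     real_distribution \<mu> \<and>
     (\<exists>K. compact K \<and> (AE x in \<mu>. x \<in> K)) \<and>
     (\<forall>k. complex_of_real (LINT x|\<mu>. x ^ k) = dual_nanotube_moment p q k)"

text \<open>
  The distribution of \<open>\<Lambda>\<^sup>*\<^bsub>p,q\<^esub>\<close>. The description is proper for \<open>(p, q) \<noteq> (0, 0)\<close>: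
  such a law exists, and a compactly supported probability measure on the reals is determined by
  its moments.
\<close>

definition dual_nanotube_law :: "nat \<Rightarrow> nat \<Rightarrow> real measure" where
  "dual_nanotube_law p q = (THE \<mu>. is_dual_nanotube_law p q \<mu>)"

definition density_V :: "real \<Rightarrow> real" where
  "density_V x = 2 / (pi * sqrt (1 - x\<^sup>2)) * indicator {0..<1} x"

end

theory Submission
  imports Defs
begin

text \<open>
  A compactly supported law is determined by its moments, so it suffices to compute moments.
  By shift invariance the triple integral is an integral over the differences \<open>a = x - z\<close> and
  \<open>b = y - z\<close>. Summing over \<open>j\<close> is Poisson summation for the trigonometric polynomial
  \<open>a \<mapsto> \<bar>1 + e\<^sup>i\<^sup>b + e\<^sup>i\<^sup>a\<bar>\<^sup>2\<^sup>k\<close> and replaces the integral over \<open>a\<close> by the average over the points with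
  \<open>p a + q b \<in> 2 \<pi> \<int>\<close>. So the law is that of \<open>\<bar>1 + e\<^sup>i\<^sup>b + e\<^sup>i\<^sup>a\<bar>\<^sup>2\<close>, with \<open>b\<close> uniform on the circle
  and \<open>a = (2 \<pi> l - q b) / p\<close>, \<open>l\<close> uniform on \<open>{0..<p}\<close>. Since \<open>V\<close> is distributed as \<open>cos \<phi>\<close> with
  \<open>\<phi>\<close> uniform on \<open>[0, \<pi>/2]\<close>, the two cases follow by symmetries of the cosine.
\<close>

section \<open>Compactly supported laws and their moments\<close>

text \<open>If \<open>\<bar>x\<bar> \<le> B\<close> almost surely, the n-th absolute moment is at
  most \<open>B ^ n\<close>, so the Taylor polynomials of the characteristic function, whose
  coefficients come from the moments, have error at most
  \<open>2 * (\<bar>t\<bar> * B) ^ n / fact n\<close>. Equal moments thus give equal characteristic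
  functions.\<close>

lemma moment_determined:
  assumes "real_distribution \<mu>" "real_distribution \<nu>"
    and "compact K" "AE x in \<mu>. x \<in> K" "compact L" "AE x in \<nu>. x \<in> L"
    and moments: "\<And>k::nat. (LINT x|\<mu>. x ^ k) = (LINT x|\<nu>. x ^ k)"
  shows "\<mu> = \<nu>"
proof -
  have char_lim: "(\<lambda>n. \<Sum>k\<le>n. (\<i> * t) ^ k / fact k * (LINT x|M. x ^ k)) \<longlonglongrightarrow> char M t"
    if M: "real_distribution M" and K: "compact K" "AE x in M. x \<in> K" for M K t
  proof -
    interpret real_distribution M by fact
    obtain B where B: "B > 0" "\<And>x. x \<in> K \<Longrightarrow> \<bar>x\<bar> \<le> B"
      using compact_imp_bounded[OF K(1)] unfolding bounded_pos by auto
    have int: "integrable M (\<lambda>x. \<bar>x\<bar> ^ n)" "integrable M (\<lambda>x. x ^ n)" for n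
      by (rule integrable_const_bound[of _ "B ^ n"];
          use K(2) in \<open>auto simp: power_abs intro!: power_mono B elim!: eventually_mono\<close>)+
    have "expectation (\<lambda>x. \<bar>x\<bar> ^ n) \<le> expectation (\<lambda>x. B ^ n)" for n
      by (rule integral_mono_AE[OF int(1)])
         (use K(2) in \<open>auto intro!: power_mono B elim!: eventually_mono\<close>)
    then have le: "expectation (\<lambda>x. \<bar>x\<bar> ^ n) \<le> B ^ n" for n
      by (simp add: prob_space del: space_eq_univ)
    have bound: "cmod ((\<Sum>k\<le>n. (\<i> * t) ^ k / fact k * expectation (\<lambda>x. x ^ k)) - char M t) \<le> 2 * ((\<bar>t\<bar> * B) ^ n /\<^sub>R fact n)" for n
    proof -
      have "cmod (char M t - (\<Sum>k\<le>n. (\<i> * t) ^ k / fact k * expectation (\<lambda>x. x ^ k))) \<le> (2 * \<bar>t\<bar> ^ n / fact n) * expectation (\<lambda>x. \<bar>x\<bar> ^ n)"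
        by (rule char_approx1) (rule int)
      also have "\<dots> \<le> (2 * \<bar>t\<bar> ^ n / fact n) * B ^ n"
        by (intro mult_left_mono le) auto
      finally show ?thesis by (simp add: norm_minus_commute power_mult_distrib field_simps)
    qed
    have "(\<lambda>n. 2 * ((\<bar>t\<bar> * B) ^ n /\<^sub>R fact n)) \<longlonglongrightarrow> 0"
      using tendsto_mult_left[OF summable_LIMSEQ_zero[OF summable_exp_generic[of "\<bar>t\<bar> * B"]], of 2] by simp
    then show ?thesis
      by (rule LIM_zero_cancel[OF Lim_null_comparison[OF always_eventually[OF allI[OF bound]]]])
  qed
  have "char \<mu> t = char \<nu> t" for t
    using char_lim[OF assms(1,3,4), of t] char_lim[OF assms(2,5,6), of t]
    unfolding moments by (rule LIMSEQ_unique)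
  then have "char \<mu> = char \<nu>" by (rule ext)
  with assms(1,2) show ?thesis by (rule Levy_uniqueness)
qed

text \<open>Uniqueness in the definite description comes from \<open>moment_determined\<close>;
  existence is settled later by exhibiting the mixture.\<close>

lemma dual_nanotube_law_eqI:
  assumes "is_dual_nanotube_law p q \<mu>"
  shows "dual_nanotube_law p q = \<mu>"
  unfolding dual_nanotube_law_def
proof (rule the_equality)
  show "is_dual_nanotube_law p q \<mu>" by fact
next
  fix \<nu> assume \<nu>: "is_dual_nanotube_law p q \<nu>"
  have "complex_of_real (LINT x|\<nu>. x ^ k) = complex_of_real (LINT x|\<mu>. x ^ k)" for k :: nat
    using assms \<nu> by (simp add: is_dual_nanotube_law_def)
  then have "(LINT x|\<nu>. x ^ k) = (LINT x|\<mu>. x ^ k)" for k :: nat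
    unfolding of_real_eq_iff .
  with assms \<nu> show "\<nu> = \<mu>"
    unfolding is_dual_nanotube_law_def by (auto intro: moment_determined)
qed

section \<open>Periodic integrals and trigonometric polynomials\<close>

text \<open>For an antiderivative \<open>F\<close>, the increment
  \<open>F (x + 2 * pi) - F x\<close> has derivative zero, so all intervals of length
  \<open>2 * pi\<close> give the same integral. This removes \<open>z\<close> from the inner
  integrals and later recentres \<open>b\<close>.\<close>

lemma integral_periodic_shift:
  fixes f :: "real \<Rightarrow> 'a::euclidean_space"
  assumes cont: "continuous_on UNIV f" and per: "\<And>x. f (x + 2 * pi) = f x"
  shows "integral {-pi..pi} (\<lambda>x. f (x + c)) = integral {-pi..pi} f"
proof -
  \<comment> \<open>The infinite end points give one antiderivative on the whole line, so
    \<open>c\<close> may be of any size.\<close>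
  have "\<exists>F. \<forall>x::real. -\<infinity> < ereal x \<longrightarrow> ereal x < \<infinity> \<longrightarrow> (F has_vector_derivative f x) (at x)"
    by (rule einterval_antiderivative) (use cont in \<open>simp_all add: continuous_on_eq_continuous_at\<close>)
  then have "\<exists>F. \<forall>x. (F has_vector_derivative f x) (at x)" by simp
  then obtain F where "\<forall>x. (F has_vector_derivative f x) (at x)" ..
  then have F: "(F has_vector_derivative f x) (at x)" for x ..
  have int: "integral {a..b} f = F b - F a" if "a \<le> b" for a b
    by (intro integral_unique fundamental_theorem_of_calculus that has_vector_derivative_at_within[OF F])
  have "((\<lambda>x. F (x + 2 * pi) - F x) has_vector_derivative 0) (at x)" for x
  proof -
    have "((\<lambda>x. x + 2 * pi) has_vector_derivative 1) (at x)"
      unfolding has_vector_derivative_def by (auto intro!: derivative_eq_intros)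
    from vector_diff_chain_at[OF this, of F] F[of "x + 2 * pi"]
    have "((\<lambda>x. F (x + 2 * pi)) has_vector_derivative f (x + 2 * pi)) (at x)"
      by (simp add: o_def)
    from has_vector_derivative_diff[OF this F[of x]] show ?thesis by (simp add: per)
  qed
  then obtain d where d: "\<And>x. F (x + 2 * pi) - F x = d"
    using has_vector_derivative_zero_constant[of UNIV "\<lambda>x. F (x + 2 * pi) - F x"] by auto
  have "integral {-pi..pi} (\<lambda>x. f (x + c)) = integral {-pi + c..pi + c} f"
    using integral_shift_real_ivl[of "-pi + c" c "pi + c" f] by simp
  also have "\<dots> = integral {-pi..pi} f"
    using d[of "-pi + c"] d[of "-pi"] by (simp add: int algebra_simps)
  finally show ?thesis .
qed

lemma set_lebesgue_integral_Icc:
  fixes f :: "real \<Rightarrow> 'a::euclidean_space"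
  assumes "continuous_on {a..b} f"
  shows "(LINT x:{a..b}|lborel. f x) = integral {a..b} f"
  by (intro set_borel_integral_eq_integral borel_integrable_atLeastAtMost' assms)

text \<open>The \<open>(-n)\<close>-th Fourier coefficient of \<open>\<lambda>a. cmod (u + v * cis a) ^ (2 * k)\<close>.\<close>

definition fourier_coeff :: "nat \<Rightarrow> int \<Rightarrow> complex \<Rightarrow> complex \<Rightarrow> complex" where
  "fourier_coeff k n u v = (\<Sum>i\<le>k. \<Sum>i'\<le>k. if int i + n = int i'
     then of_nat (k choose i) * v ^ i * u ^ (k - i) * cnj (of_nat (k choose i') * v ^ i' * u ^ (k - i'))
     else 0)"

text \<open>With \<open>w = u + v * cis a\<close>, write the left side as
  \<open>w ^ k * cnj (w ^ k)\<close> and expand both factors binomially.\<close>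

lemma cmod_add_cis_power:
  "complex_of_real (cmod (u + v * cis a) ^ (2 * k)) = (\<Sum>i\<le>k. \<Sum>i'\<le>k.
     of_nat (k choose i) * v ^ i * u ^ (k - i) * cnj (of_nat (k choose i') * v ^ i' * u ^ (k - i'))
     * cis (of_int (int i - int i') * a))"
proof -
  have pow: "(u + v * cis a) ^ k = (\<Sum>i\<le>k. of_nat (k choose i) * v ^ i * u ^ (k - i) * cis (of_nat i * a))"
    by (subst add.commute, subst binomial_ring) (simp add: power_mult_distrib Complex.DeMoivre mult_ac)
  have "complex_of_real (cmod (u + v * cis a) ^ (2 * k)) = (u + v * cis a) ^ k * cnj ((u + v * cis a) ^ k)"
    unfolding complex_norm_square[symmetric] by (simp add: norm_power mult.commute flip: power_mult)
  also have "\<dots> = (\<Sum>i\<le>k. \<Sum>i'\<le>k.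
     of_nat (k choose i) * v ^ i * u ^ (k - i) * cnj (of_nat (k choose i') * v ^ i' * u ^ (k - i'))
     * (cis (of_nat i * a) * cnj (cis (of_nat i' * a))))"
    unfolding pow cnj_sum sum_product by (simp add: mult_ac)
  finally show ?thesis by (simp add: cis_cnj cis_mult algebra_simps)
qed

lemma has_integral_cis:
  "((\<lambda>a. cis (of_int m * a)) has_integral (if m = 0 then 2 * pi else 0)) {-pi..pi}"
proof (cases "m = 0")
  case True
  then show ?thesis using has_integral_const_real[of "1::complex" "-pi" pi]
    by (simp add: scaleR_conv_of_real)
next
  case False
  have "((\<lambda>a. cis (of_int m * a)) has_integral
      (cis (of_int m * pi) / (\<i> * of_int m) - cis (of_int m * (-pi)) / (\<i> * of_int m))) {-pi..pi}"
    using False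
    by (intro fundamental_theorem_of_calculus)
       (auto intro!: derivative_eq_intros simp: has_vector_derivative_def scaleR_conv_of_real fun_eq_iff
          complex_eq_iff)
  moreover have "cis (of_int m * pi) = cis (of_int m * (-pi))"
    by (simp add: complex_eq_iff mult.commute[of _ pi])
  ultimately show ?thesis using False by simp
qed

text \<open>Orthogonality of the exponentials keeps exactly the terms with
  \<open>i + n = i'\<close>.\<close>

lemma has_integral_cmod_power_cis:
  "((\<lambda>a. complex_of_real (cmod (u + v * cis a) ^ (2 * k)) * cis (of_int n * a))
     has_integral (2 * pi * fourier_coeff k n u v)) {-pi..pi}"
proof -
  let ?c = "\<lambda>i i'. of_nat (k choose i) * v ^ i * u ^ (k - i)
      * cnj (of_nat (k choose i') * v ^ i' * u ^ (k - i'))"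
  have eq: "complex_of_real (cmod (u + v * cis a) ^ (2 * k)) * cis (of_int n * a) =
      (\<Sum>i\<le>k. \<Sum>i'\<le>k. ?c i i' * cis (of_int (int i + n - int i') * a))" for a
    unfolding cmod_add_cis_power sum_distrib_right mult.assoc cis_mult
    by (simp add: algebra_simps)
  have "((\<lambda>a. \<Sum>i\<le>k. \<Sum>i'\<le>k. ?c i i' * cis (of_int (int i + n - int i') * a)) has_integral
      (\<Sum>i\<le>k. \<Sum>i'\<le>k. ?c i i' * (if int i + n - int i' = 0 then 2 * pi else 0))) {-pi..pi}"
    by (intro has_integral_sum finite_atMost has_integral_mult_right has_integral_cis)
  moreover have "(\<Sum>i\<le>k. \<Sum>i'\<le>k. ?c i i' * (if int i + n - int i' = 0 then 2 * pi else 0)) =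
      2 * pi * fourier_coeff k n u v"
    unfolding fourier_coeff_def sum_distrib_left by (intro sum.cong refl) auto
  ultimately show ?thesis unfolding eq by simp
qed

text \<open>A geometric sum over the powers of \<open>z\<close>, a \<open>p\<close>-th root of unity
  that is \<open>1\<close> exactly when \<open>p\<close> divides \<open>m\<close>.\<close>

lemma sum_cis_roots_unity:
  assumes "p > 0"
  shows "(\<Sum>l<p. cis (of_int m * (2 * pi * real l / real p))) = (if int p dvd m then of_nat p else 0)"
proof -
  define z where "z = cis (of_int m * (2 * pi / real p))"
  have pow: "cis (of_int m * (2 * pi * real l / real p)) = z ^ l" for l
    unfolding z_def Complex.DeMoivre by (simp add: mult_ac)
  have z1: "z = 1 \<longleftrightarrow> int p dvd m"
  proof
    assume "z = 1"
    then have "cos (of_int m * (2 * pi / real p)) = 1" by (simp add: z_def complex_eq_iff)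
    then obtain n :: int where "of_int m * (2 * pi / real p) = of_int n * 2 * pi"
      unfolding cos_one_2pi_int by blast
    then have "real_of_int m = real_of_int (int p * n)" using assms by (simp add: field_simps)
    then show "int p dvd m" unfolding of_int_eq_iff by simp
  next
    assume "int p dvd m"
    then obtain n where "m = int p * n" by auto
    then show "z = 1" using assms cis_multiple_2pi[of "of_int n"] by (simp add: z_def mult_ac)
  qed
  have "z ^ p = 1"
    using assms cis_multiple_2pi[of "of_int m"] by (simp add: z_def Complex.DeMoivre mult_ac)
  then show ?thesis
    unfolding pow using z1 by (auto simp: geometric_sum)
qed

lemma fourier_coeff_eq_0: "\<bar>n\<bar> > int k \<Longrightarrow> fourier_coeff k n u v = 0"
  unfolding fourier_coeff_def by (intro sum.neutral ballI) auto

text \<open>Poisson summation in finite form. For each pair \<open>(i, i')\<close> both sides test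
  whether \<open>p\<close> divides \<open>i - i'\<close>: the left by the single \<open>j\<close>
  with \<open>i + j * p = i'\<close>, the right by a sum over roots of unity.\<close>

lemma sum_fourier_coeff:
  assumes "p > 0"
  shows "(\<Sum>j\<in>{-int k..int k}. fourier_coeff k (j * int p) u v) =
    (\<Sum>l<p. complex_of_real (cmod (u + v * cis (2 * pi * real l / real p)) ^ (2 * k))) / of_nat p"
proof -
  have count: "(\<Sum>j\<in>{-int k..int k}. if int i + j * int p = int i' then c else 0)
     = c * (\<Sum>l<p. cis (of_int (int i - int i') * (2 * pi * real l / real p))) / of_nat p"
    if "i \<le> k" "i' \<le> k" for i i' c
  proof (cases "int p dvd int i - int i'")
    case True
    then obtain d where d: "int i - int i' = int p * d" by auto
    \<comment> \<open>As \<open>p \<ge> 1\<close>, the quotient \<open>d\<close> is at most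
      \<open>\<bar>i - i'\<bar> \<le> k\<close> in modulus, so the range of \<open>j\<close>
      contains the only solution \<open>- d\<close>.\<close>
    have "\<bar>d\<bar> \<le> int p * \<bar>d\<bar>" using assms by (simp add: mult_le_cancel_right1)
    also have "\<dots> = \<bar>int i - int i'\<bar>" using d by (simp add: abs_mult)
    finally have "- d \<in> {-int k..int k}" using that by auto
    moreover have "int i + j * int p = int i' \<longleftrightarrow> j = - d" for j
    proof -
      have "int i + j * int p = int i' \<longleftrightarrow> int p * (j + d) = 0" using d by (auto simp: algebra_simps)
      then show ?thesis using assms by auto
    qed
    ultimately show ?thesis unfolding sum_cis_roots_unity[OF assms] using True assms by simp
  next
    case False
    have "int i + j * int p \<noteq> int i'" for j
    proof
      assume "int i + j * int p = int i'"
      then have "int i - int i' = int p * (-j)" by (simp add: algebra_simps)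
      then show False using False by simp
    qed
    then show ?thesis unfolding sum_cis_roots_unity[OF assms] using False by simp
  qed
  have "(\<Sum>j\<in>{-int k..int k}. fourier_coeff k (j * int p) u v) = (\<Sum>i\<le>k. \<Sum>i'\<le>k. \<Sum>j\<in>{-int k..int k}.
     if int i + j * int p = int i'
     then of_nat (k choose i) * v ^ i * u ^ (k - i) * cnj (of_nat (k choose i') * v ^ i' * u ^ (k - i'))
     else 0)"
    unfolding fourier_coeff_def
    by (simp only: sum.swap[where A="{-int k..int k}" and B="{..k}"])
  also have "\<dots> = (\<Sum>i\<le>k. \<Sum>i'\<le>k. \<Sum>l<p. of_nat (k choose i) * v ^ i * u ^ (k - i) * cnj (of_nat (k choose i') * v ^ i' * u ^ (k - i'))
     * cis (of_int (int i - int i') * (2 * pi * real l / real p)) / of_nat p)"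
  proof (intro sum.cong refl, goal_cases)
    case (1 i i')
    then have "i \<le> k" "i' \<le> k" by auto
    from count[OF this] show ?case by (simp only: sum_distrib_left sum_divide_distrib)
  qed
  also have "\<dots> = (\<Sum>l<p. \<Sum>i\<le>k. \<Sum>i'\<le>k. of_nat (k choose i) * v ^ i * u ^ (k - i) * cnj (of_nat (k choose i') * v ^ i' * u ^ (k - i'))
     * cis (of_int (int i - int i') * (2 * pi * real l / real p)) / of_nat p)"
    by (simp only: sum.swap[where A="{..k}" and B="{..<p}"])
  finally show ?thesis by (simp only: cmod_add_cis_power sum_divide_distrib)
qed

text \<open>Rotating \<open>v\<close> translates the variable \<open>a\<close>, and every
  contributing pair has \<open>i' - i = n\<close>, hence the same phase. This serves to absorb the
  phase \<open>cis (j * q * b)\<close> into \<open>v\<close>.\<close>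

lemma fourier_coeff_cis:
  "fourier_coeff k n u (v * cis t) = fourier_coeff k n u v * cis (- of_int n * t)"
  unfolding fourier_coeff_def sum_distrib_right
proof (intro sum.cong refl, goal_cases)
  case (1 i i')
  show ?case
  proof (cases "int i + n = int i'")
    case True
    then have n: "n = int i' - int i" by simp
    have "cis t ^ i * cnj (cis t ^ i') = cis (- of_int n * t)"
      unfolding n by (simp add: Complex.DeMoivre cis_cnj cis_mult algebra_simps)
    then show ?thesis by (simp add: True power_mult_distrib mult_ac)
  qed simp
qed

lemma continuous_on_fourier_coeff [continuous_intros]:
  fixes u v :: "'a::topological_space \<Rightarrow> complex"
  assumes "continuous_on A u" "continuous_on A v"
  shows "continuous_on A (\<lambda>x. fourier_coeff k n (u x) (v x))"
  unfolding fourier_coeff_def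
proof (intro continuous_on_sum)
  show "continuous_on A (\<lambda>x. if int i + n = int i'
     then of_nat (k choose i) * v x ^ i * u x ^ (k - i) * cnj (of_nat (k choose i') * v x ^ i' * u x ^ (k - i'))
     else 0)" for i i'
    by (cases "int i + n = int i'") (simp_all, intro continuous_intros assms)
qed

section \<open>Poisson summation for the nanotube moments\<close>

text \<open>\<open>H j b\<close> is the integral over \<open>a = x - z\<close> at
  \<open>b = y - z\<close>. Of the three factors \<open>2 * pi\<close> in the normalisation, one
  cancels against the integral over \<open>z\<close> and one against the Fourier coefficient; the
  factor \<open>p\<close> comes from averaging over the \<open>p\<close> nodes.\<close>

lemma dual_nanotube_moment_eq:
  assumes p: "p > 0"
  shows "dual_nanotube_moment p q k = complex_of_real ((\<Sum>l<p. integral {-pi..pi} (\<lambda>b.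
    cmod (1 + cis b + cis (2 * pi * real l / real p - real q * b / real p)) ^ (2 * k))) / (2 * pi * real p))"
proof -
  define H where "H j b = 2 * pi * fourier_coeff k (j * int p) (1 + cis b) 1 * cis (of_int j * real q * b)"
    for j :: int and b :: real
  \<comment> \<open>The phase depending on \<open>j\<close> becomes a rotation of \<open>v\<close>
    by \<open>- q * b / p\<close>, the same for all \<open>j\<close>, so that
    \<open>sum_fourier_coeff\<close> applies; it moves the nodes \<open>2 * pi * l / p\<close> to
    \<open>(2 * pi * l - q * b) / p\<close>.\<close>
  have H_alt: "H j b = 2 * pi * fourier_coeff k (j * int p) (1 + cis b) (cis (- (real q * b / real p)))" for j b
    using fourier_coeff_cis[of k "j * int p" "1 + cis b" 1 "- (real q * b / real p)"] p
    by (simp add: H_def mult.assoc)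
  have H_cont: "continuous_on A (H j)" for A j
    unfolding H_def by (intro continuous_intros)
  \<comment> \<open>Periodicity is read off from \<open>H_def\<close>, where \<open>j * q\<close> is
    an integer; \<open>H_alt\<close> contains \<open>b / p\<close> and does not show it.\<close>
  have H_per: "H j (b + 2 * pi) = H j b" for j b
  proof -
    have "cis (b + 2 * pi) = cis b" by (simp flip: cis_mult)
    moreover have "cis (of_int j * real q * (b + 2 * pi)) = cis (of_int j * real q * b)"
      using cis_multiple_2pi[of "of_int (j * int q)"]
      by (simp add: ring_distribs mult_ac flip: cis_mult)
    ultimately show ?thesis by (simp add: H_def)
  qed
  have inner: "(LINT x:{-pi..pi}|lborel. complex_of_real (cmod (cis x + cis y + cis z) ^ (2 * k)) *
      cis (of_int j * (real p * (x - z) + real q * (y - z)))) = H j (y - z)" for j y z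
  proof -
    define h where "h a = complex_of_real (cmod ((1 + cis (y - z)) + 1 * cis a) ^ (2 * k)) * cis (of_int (j * int p) * a)" for a
    have h_cont: "continuous_on A h" for A unfolding h_def by (intro continuous_intros)
    have h_per: "h (a + 2 * pi) = h a" for a
    proof -
      have "cis (a + 2 * pi) = cis a" by (simp flip: cis_mult)
      moreover have "cis (of_int (j * int p) * (a + 2 * pi)) = cis (of_int (j * int p) * a)"
        using cis_multiple_2pi[of "of_int (j * int p)"]
        by (simp add: ring_distribs mult_ac flip: cis_mult)
      ultimately show ?thesis by (simp add: h_def)
    qed
    have "complex_of_real (cmod (cis x + cis y + cis z) ^ (2 * k)) *
        cis (of_int j * (real p * (x - z) + real q * (y - z))) = h (x + (- z)) * cis (of_int j * real q * (y - z))" for x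
    proof -
      \<comment> \<open>The unimodular factor \<open>cis z\<close> does not affect the modulus, so
        only \<open>x - z\<close> and \<open>y - z\<close> remain.\<close>
      have "cis x + cis y + cis z = cis z * ((1 + cis (y - z)) + 1 * cis (x + (- z)))"
        by (simp add: ring_distribs cis_mult)
      then have "cmod (cis x + cis y + cis z) = cmod ((1 + cis (y - z)) + 1 * cis (x + (- z)))"
        by (metis norm_mult norm_cis mult_1)
      moreover have "cis (of_int j * (real p * (x - z) + real q * (y - z))) =
          cis (of_int (j * int p) * (x + (- z))) * cis (of_int j * real q * (y - z))"
        by (simp add: cis_mult algebra_simps)
      ultimately show ?thesis by (simp add: h_def)
    qed
    then have "(LINT x:{-pi..pi}|lborel. complex_of_real (cmod (cis x + cis y + cis z) ^ (2 * k)) *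
        cis (of_int j * (real p * (x - z) + real q * (y - z)))) =
        (LINT x:{-pi..pi}|lborel. h (x + (- z))) * cis (of_int j * real q * (y - z))"
      by simp
    also have "(LINT x:{-pi..pi}|lborel. h (x + (- z))) = integral {-pi..pi} h"
      by (subst set_lebesgue_integral_Icc)
         (intro continuous_on_compose2[OF h_cont[of UNIV]] continuous_intros integral_periodic_shift h_cont h_per; simp)+
    also have "\<dots> = 2 * pi * fourier_coeff k (j * int p) (1 + cis (y - z)) 1"
      unfolding h_def by (intro integral_unique has_integral_cmod_power_cis)
    finally show ?thesis by (simp add: H_def)
  qed
  have middle: "(LINT y:{-pi..pi}|lborel. H j (y - z)) = integral {-pi..pi} (H j)" for j z
    using integral_periodic_shift[OF H_cont H_per, of j "- z"]
    by (subst set_lebesgue_integral_Icc) (auto intro!: continuous_on_compose2[OF H_cont[of UNIV]] continuous_intros)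
  have outer: "(LINT z:{-pi..pi}|lborel. c) = 2 * pi * c" for c :: complex
    by (subst set_lebesgue_integral_Icc) (auto simp: scaleR_conv_of_real)
  have "dual_nanotube_moment p q k =
      1 / (2 * of_real pi) ^ 3 * (\<Sum>\<^sub>\<infinity>j\<in>UNIV. 2 * pi * integral {-pi..pi} (H j))"
    unfolding dual_nanotube_moment_def inner middle outer ..
  \<comment> \<open>Coefficients of index beyond \<open>k\<close> vanish and
    \<open>\<bar>j * p\<bar> \<ge> \<bar>j\<bar>\<close>; the sum is then finite and can be taken
    inside the integral.\<close>
  also have "(\<Sum>\<^sub>\<infinity>j\<in>UNIV. 2 * pi * integral {-pi..pi} (H j)) =
      (\<Sum>\<^sub>\<infinity>j\<in>{-int k..int k}. 2 * pi * integral {-pi..pi} (H j))"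
  proof (rule infsum_cong_neutral)
    fix j :: int assume "j \<in> UNIV - {-int k..int k}"
    then have "int k < \<bar>j\<bar>" by auto
    also have "\<bar>j\<bar> \<le> \<bar>j * int p\<bar>" using p by (simp add: abs_mult mult_le_cancel_left1)
    finally have "H j = (\<lambda>_. 0)" by (simp add: H_def fourier_coeff_eq_0 fun_eq_iff)
    then show "2 * pi * integral {-pi..pi} (H j) = 0" by simp
  qed auto
  also have "\<dots> = 2 * pi * integral {-pi..pi} (\<lambda>b. \<Sum>j\<in>{-int k..int k}. H j b)"
    by (simp add: sum_distrib_left integral_sum integrable_continuous_real H_cont)
  also have "(\<lambda>b. \<Sum>j\<in>{-int k..int k}. H j b) = (\<lambda>b. complex_of_real (2 * pi / real p *
     (\<Sum>l<p. cmod (1 + cis b + cis (2 * pi * real l / real p - real q * b / real p)) ^ (2 * k))))"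
  proof
    fix b
    have "(\<Sum>j\<in>{-int k..int k}. H j b) = 2 * pi * ((\<Sum>l<p. complex_of_real
        (cmod (1 + cis b + cis (- (real q * b / real p)) * cis (2 * pi * real l / real p)) ^ (2 * k))) / of_nat p)"
      unfolding H_alt sum_distrib_left[symmetric] sum_fourier_coeff[OF p] ..
    then show "(\<Sum>j\<in>{-int k..int k}. H j b) = complex_of_real (2 * pi / real p *
     (\<Sum>l<p. cmod (1 + cis b + cis (2 * pi * real l / real p - real q * b / real p)) ^ (2 * k)))"
      by (simp add: cis_mult)
  qed
  also have "integral {-pi..pi} \<dots> = complex_of_real (2 * pi / real p *
     (\<Sum>l<p. integral {-pi..pi} (\<lambda>b. cmod (1 + cis b + cis (2 * pi * real l / real p - real q * b / real p)) ^ (2 * k))))"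
    (is "integral _ (\<lambda>b. complex_of_real (_ * (\<Sum>l<p. ?g l b))) = _")
  proof -
    have g: "(?g l has_integral integral {-pi..pi} (?g l)) {-pi..pi}" for l
      by (intro integrable_integral integrable_continuous_real continuous_intros) (use p in simp)
    show ?thesis
      by (intro integral_unique has_integral_of_real has_integral_mult_right has_integral_sum g finite_lessThan)
  qed
  finally show ?thesis using p by (simp add: power3_eq_cube field_simps)
qed

section \<open>The law of \<open>V\<close> as the cosine of a uniform angle\<close>

text \<open>Under \<open>v = cos \<phi>\<close> the Jacobian \<open>sin \<phi>\<close> cancels
  \<open>sqrt (1 - v\<^sup>2)\<close>, which leaves the constant density \<open>2 / pi\<close> on
  \<open>[0, pi/2]\<close>.\<close>

lemma lborel_integral_density_V:
  assumes g: "continuous_on UNIV g"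
  shows "(LINT v|lborel. density_V v * g v) = 2 / pi * integral {0..pi/2} (\<lambda>\<phi>. g (cos \<phi>))"
proof -
  define F where "F v = 2 / (pi * sqrt (1 - v\<^sup>2)) * g v" for v
  have g_meas [measurable]: "g \<in> borel_measurable borel"
    using g by (rule borel_measurable_continuous_onI)
  have cos_range: "cos ` {0<..<pi/2} = {0<..<1}"
  proof (intro equalityI subsetI)
    fix v :: real assume "v \<in> cos ` {0<..<pi/2}"
    then show "v \<in> {0<..<1}" using cos_monotone_0_pi[of 0] by (auto intro!: cos_gt_zero)
  next
    fix v :: real assume "v \<in> {0<..<1}"
    then show "v \<in> cos ` {0<..<pi/2}"
      using arccos_less_arccos[of 0 v] arccos_less_arccos[of v 1]
      by (intro image_eqI[of _ _ "arccos v"]) auto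
  qed
  have subst: "\<bar>- sin \<phi>\<bar> * F (cos \<phi>) = 2 / pi * g (cos \<phi>)" if "\<phi> \<in> {0<..<pi/2}" for \<phi>
  proof -
    have "sin \<phi> > 0" using that by (intro sin_gt_zero) auto
    then show ?thesis by (simp add: F_def flip: sin_squared_eq)
  qed
  have cont: "continuous_on A (\<lambda>\<phi>. 2 / pi * g (cos \<phi>))" for A
    by (intro continuous_intros continuous_on_compose2[OF g]) auto
  \<comment> \<open>Integrability is checked in the angle, where the integrand is continuous; the
    change of variables carries it over to \<open>F\<close>, which may be unbounded near
    \<open>1\<close>.\<close>
  have "(\<lambda>\<phi>. 2 / pi * g (cos \<phi>)) absolutely_integrable_on {0<..<pi/2}"
    by (rule set_integrable_subset[OF absolutely_integrable_continuous_real[OF cont[of "{0..pi/2}"]]]) auto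
  then have "(\<lambda>\<phi>. \<bar>- sin \<phi>\<bar> * F (cos \<phi>)) absolutely_integrable_on {0<..<pi/2}"
    by (subst set_integrable_cong[OF refl refl subst]) auto
  moreover have "integral {0<..<pi/2} (\<lambda>\<phi>. \<bar>- sin \<phi>\<bar> * F (cos \<phi>)) = 2 / pi * integral {0..pi/2} (\<lambda>\<phi>. g (cos \<phi>))"
    by (subst integral_cong[OF subst]) (simp_all add: integral_open_interval_real)
  moreover have "inj_on cos {0<..<pi/2::real}"
    by (intro inj_onI) (auto intro: cos_inj_pi)
  moreover have "(cos has_real_derivative - sin \<phi>) (at \<phi> within {0<..<pi/2})" for \<phi>
    by (auto intro!: derivative_eq_intros)
  ultimately have F: "F absolutely_integrable_on {0<..<1}"
      "integral {0<..<1} F = 2 / pi * integral {0..pi/2} (\<lambda>\<phi>. g (cos \<phi>))"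
    using has_absolute_integral_change_of_variables_1'[of "{0<..<pi/2}" cos "\<lambda>\<phi>. - sin \<phi>" F
        "2 / pi * integral {0..pi/2} (\<lambda>\<phi>. g (cos \<phi>))"]
    unfolding cos_range by simp_all
  have "(LINT v|lborel. density_V v * g v) = (LINT v|lborel. indicator {0<..<1} v *\<^sub>R F v)"
  proof (rule integral_cong_AE)
    \<comment> \<open>\<open>density_V\<close> includes the point \<open>0\<close>, the open
      interval does not; it is a null set.\<close>
    show "AE v in lborel. density_V v * g v = indicator {0<..<1} v *\<^sub>R F v"
      using AE_lborel_singleton[of "0::real"]
      by eventually_elim (auto simp: density_V_def F_def split: split_indicator)
  qed (simp_all add: density_V_def F_def)
  also have "\<dots> = (LINT v:{0<..<1}|lebesgue. F v)"
    unfolding set_lebesgue_integral_def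
    by (rule integral_completion[symmetric]) (simp add: F_def)
  also have "\<dots> = integral {0<..<1} F" by (rule set_lebesgue_integral_eq_integral[OF F(1)])
  finally show ?thesis unfolding F(2) .
qed

lemma density_V_nonneg: "0 \<le> density_V x"
  by (cases "x \<in> {0..<1}") (simp_all add: density_V_def power_le_one)

section \<open>Mixtures over an independent uniform index\<close>

context prob_space
begin

context
  fixes V :: "'a \<Rightarrow> real" and J :: "'a \<Rightarrow> nat" and N :: nat and g :: "nat \<Rightarrow> real \<Rightarrow> real"
  assumes V: "distributed M lborel V (\<lambda>x. ennreal (density_V x))"
    and J: "distr M (count_space UNIV) J = measure_pmf (pmf_of_set {0..<N})" and N: "N > 0"
    and indep: "indep_var borel V borel (\<lambda>\<omega>. real (J \<omega>))"
    and g: "\<And>l. continuous_on UNIV (g l)"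
begin

lemma measurable_V: "V \<in> borel_measurable M"
  using distributed_measurable[OF V] by simp

text \<open>Independence includes measurability of \<open>real (J \<omega>)\<close>; rounding down
  gives back \<open>J\<close>.\<close>

lemma measurable_J: "J \<in> measurable M (count_space UNIV)"
proof -
  have "(\<lambda>\<omega>. nat \<lfloor>real (J \<omega>)\<rfloor>) \<in> measurable M (count_space UNIV)"
    using indep_var_rv2[OF indep] by measurable
  then show ?thesis by simp
qed

lemma measurable_mixture: "(\<lambda>\<omega>. g (J \<omega>) (V \<omega>)) \<in> borel_measurable M"
proof (rule measurable_compose_countable[OF _ measurable_J])
  show "(\<lambda>\<omega>. g l (V \<omega>)) \<in> borel_measurable M" for l
    using borel_measurable_continuous_onI[OF g] measurable_V by (rule measurable_compose[rotated])
qed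

text \<open>The closed interval is taken so that its images under the continuous \<open>g l\<close>
  are compact.\<close>

lemma AE_V: "AE \<omega> in M. V \<omega> \<in> {0..1}"
proof -
  have "AE x in lborel. 0 < ennreal (density_V x) \<longrightarrow> x \<in> {0..1}"
    by (rule AE_I2) (auto simp: density_V_def split: split_indicator_asm)
  then show ?thesis
    by (subst distributed_AE2[OF V]) auto
qed

lemma AE_J: "AE \<omega> in M. J \<omega> \<in> {..<N}"
proof -
  have "AE l in distr M (count_space UNIV) J. l \<in> {..<N}"
    unfolding J AE_measure_pmf_iff using N by (subst set_pmf_of_set) auto
  then show ?thesis by (subst (asm) AE_distr_iff[OF measurable_J]) auto
qed

lemma AE_mixture: "AE \<omega> in M. g (J \<omega>) (V \<omega>) \<in> (\<Union>l<N. g l ` {0..1})"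
  using AE_V AE_J by eventually_elim blast

lemma compact_mixture: "compact (\<Union>l<N. g l ` {0..1})"
  by (intro compact_UN compact_continuous_image continuous_on_subset[OF g]) auto

text \<open>Almost surely the mixture is the sum over \<open>l\<close> of
  \<open>g l (V \<omega>)\<close> times the indicator of \<open>J \<omega> = l\<close>. Independence
  factors each term into a cosine integral and \<open>1 / N\<close>.\<close>

lemma expectation_mixture:
  "expectation (\<lambda>\<omega>. g (J \<omega>) (V \<omega>)) = (\<Sum>l<N. 2 / pi * integral {0..pi/2} (\<lambda>\<phi>. g l (cos \<phi>))) / real N"
proof -
  have g_meas: "g l \<in> borel_measurable borel" for l
    using g by (rule borel_measurable_continuous_onI)
  have g_V: "integrable M (\<lambda>\<omega>. g l (V \<omega>))" for l
  proof -
    have "compact (g l ` {0..1})" by (intro compact_continuous_image continuous_on_subset[OF g]) auto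
    then obtain B where B: "\<And>y. y \<in> g l ` {0..1} \<Longrightarrow> norm y \<le> B"
      by (meson compact_imp_bounded bounded_iff)
    have "AE \<omega> in M. norm (g l (V \<omega>)) \<le> B"
      using AE_V by eventually_elim (blast intro: B)
    then show ?thesis
      by (rule integrable_const_bound) (rule measurable_compose[OF measurable_V g_meas])
  qed
  \<comment> \<open>The indicator is taken of \<open>real (J \<omega>)\<close> because independence
    is stated for this real variable.\<close>
  have J_l: "integrable M (\<lambda>\<omega>. indicator {real l} (real (J \<omega>)) :: real)" for l
    using indep_var_rv2[OF indep]
    by (intro integrable_const_bound[of _ 1]) (auto split: split_indicator)
  have E_J: "expectation (\<lambda>\<omega>. indicator {real l} (real (J \<omega>))) = 1 / real N" if "l < N" for l
  proof -
    have "expectation (\<lambda>\<omega>. indicator {real l} (real (J \<omega>))) =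
        integral\<^sup>L (distr M (count_space UNIV) J) (\<lambda>j. indicator {real l} (real j) :: real)"
      by (subst integral_distr[OF measurable_J]) auto
    also have "\<dots> = (\<Sum>j\<in>{0..<N}. indicator {real l} (real j)) / real N"
      unfolding J using N by (subst integral_pmf_of_set) auto
    also have "(\<Sum>j\<in>{0..<N}. indicator {real l} (real j) :: real) = 1"
      using that by (subst sum.remove[of _ l]) (auto simp: indicator_def)
    finally show ?thesis .
  qed
  have E_V: "expectation (\<lambda>\<omega>. g l (V \<omega>)) = 2 / pi * integral {0..pi/2} (\<lambda>\<phi>. g l (cos \<phi>))" for l
    using distributed_integral[OF V, of "g l"] g_meas
    by (simp add: density_V_nonneg lborel_integral_density_V[OF g])
  have iv: "indep_var borel (\<lambda>\<omega>. g l (V \<omega>)) borel (\<lambda>\<omega>. indicator {real l} (real (J \<omega>)) :: real)" for l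
    using indep_var_compose[OF indep g_meas, of "indicator {real l}" borel l] by (simp add: o_def)
  have "expectation (\<lambda>\<omega>. g (J \<omega>) (V \<omega>)) =
      expectation (\<lambda>\<omega>. \<Sum>l<N. g l (V \<omega>) * indicator {real l} (real (J \<omega>)))"
  proof (rule integral_cong_AE)
    show "AE \<omega> in M. g (J \<omega>) (V \<omega>) = (\<Sum>l<N. g l (V \<omega>) * indicator {real l} (real (J \<omega>)))"
      using AE_J
    proof eventually_elim
      case (elim \<omega>)
      then show ?case by (subst sum.remove[of _ "J \<omega>"]) (auto simp: indicator_def)
    qed
    show "(\<lambda>\<omega>. \<Sum>l<N. g l (V \<omega>) * indicator {real l} (real (J \<omega>))) \<in> borel_measurable M"
      using indep_var_integrable[OF iv g_V J_l] by (intro borel_measurable_sum borel_measurable_integrable)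
  qed (rule measurable_mixture)
  also have "\<dots> = (\<Sum>l<N. expectation (\<lambda>\<omega>. g l (V \<omega>) * indicator {real l} (real (J \<omega>))))"
    by (intro Bochner_Integration.integral_sum indep_var_integrable iv g_V J_l)
  also have "\<dots> = (\<Sum>l<N. (2 / pi * integral {0..pi/2} (\<lambda>\<phi>. g l (cos \<phi>))) * (1 / real N))"
    by (intro sum.cong refl) (simp only: indep_var_lebesgue_integral[OF iv g_V J_l] E_V E_J lessThan_iff)
  finally show ?thesis by (simp add: sum_divide_distrib)
qed

end

text \<open>Reduces both cases to a moment identity: \<open>expectation_mixture\<close> applied to
  the powers \<open>g l v ^ k\<close> gives every moment of the mixture.\<close>

lemma dual_nanotube_law_mixture:
  fixes g :: "nat \<Rightarrow> real \<Rightarrow> real"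
  assumes V: "distributed M lborel V (\<lambda>x. ennreal (density_V x))"
    and J: "distr M (count_space UNIV) J = measure_pmf (pmf_of_set {0..<N})" and N: "N > 0"
    and indep: "indep_var borel V borel (\<lambda>\<omega>. real (J \<omega>))"
    and g: "\<And>l. continuous_on UNIV (g l)"
    and moment: "\<And>k. dual_nanotube_moment p q k =
      complex_of_real ((\<Sum>l<N. 2 / pi * integral {0..pi/2} (\<lambda>\<phi>. g l (cos \<phi>) ^ k)) / real N)"
  shows "dual_nanotube_law p q = distr M borel (\<lambda>\<omega>. g (J \<omega>) (V \<omega>))"
proof (rule dual_nanotube_law_eqI, unfold is_dual_nanotube_law_def, intro conjI exI allI)
  note meas = measurable_mixture[OF V J N indep, of g, OF g]
  show "real_distribution (distr M borel (\<lambda>\<omega>. g (J \<omega>) (V \<omega>)))"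
    by (rule real_distribution_distr) (rule meas)
  define K where "K = (\<Union>l<N. g l ` {0..1})"
  show "compact K"
    unfolding K_def by (rule compact_mixture[OF V J N indep, of g, OF g])
  then have "K \<in> sets borel" by (rule borel_compact)
  then show "AE x in distr M borel (\<lambda>\<omega>. g (J \<omega>) (V \<omega>)). x \<in> K"
    using AE_mixture[OF V J N indep, of g, OF g, folded K_def] by (subst AE_distr_iff[OF meas]) simp_all
  have pow: "(\<lambda>x. x ^ k) \<in> borel_measurable (borel :: real measure)" for k by measurable
  show "complex_of_real (LINT x|distr M borel (\<lambda>\<omega>. g (J \<omega>) (V \<omega>)). x ^ k) = dual_nanotube_moment p q k" for k
    unfolding moment integral_distr[OF meas pow]
    by (subst expectation_mixture[OF V J N indep, of "\<lambda>l v. g l v ^ k"]) (intro continuous_intros g, rule refl)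
qed

end

section \<open>Moments of the zigzag and armchair tubes\<close>

lemma integral_symmetric_Icc:
  fixes f :: "real \<Rightarrow> real"
  assumes "a \<ge> 0" "continuous_on UNIV f"
  shows "integral {-a..a} f = integral {0..a} f + integral {0..a} (\<lambda>x. f (- x))"
proof -
  have "integral {-a..0} f + integral {0..a} f = integral {-a..a} f"
    by (rule Henstock_Kurzweil_Integration.integral_combine)
       (use assms in \<open>auto intro!: integrable_continuous_real continuous_on_subset[OF assms(2)]\<close>)
  then show ?thesis using Henstock_Kurzweil_Integration.integral_reflect_real[of 0 "- a" f] by simp
qed

lemma cmod_sum3_cis: "(cmod (1 + cis b + cis a))\<^sup>2 = 3 + 2 * cos a + 2 * cos b + 2 * cos (a - b)"
proof -
  have "(cmod (1 + cis b + cis a))\<^sup>2 = (1 + cos b + cos a)\<^sup>2 + (sin b + sin a)\<^sup>2"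
    by (simp add: cmod_power2)
  also have "\<dots> = 1 + ((sin a)\<^sup>2 + (cos a)\<^sup>2) + ((sin b)\<^sup>2 + (cos b)\<^sup>2)
      + 2 * cos a + 2 * cos b + 2 * (cos a * cos b + sin a * sin b)"
    unfolding power2_eq_square by (simp only: algebra_simps one_add_one[symmetric])
  finally show ?thesis by (simp add: cos_diff)
qed

text \<open>For \<open>q = 0\<close> the nodes do not depend on \<open>b\<close>. Setting
  \<open>b = 2 * \<phi>\<close> and using the double-angle formulas gives the stated expression, as
  \<open>sin \<phi> = sqrt (1 - (cos \<phi>)\<^sup>2)\<close> on \<open>[0, pi/2]\<close>.\<close>

lemma dual_nanotube_moment_zigzag:
  assumes p: "p > 0"
  shows "dual_nanotube_moment p 0 k = complex_of_real ((\<Sum>l<p. 2 / pi * integral {0..pi/2} (\<lambda>\<phi>.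
    (4 * (1 + cos (2 * pi * real l / real p)) * (cos \<phi>)\<^sup>2
     - 4 * sin (2 * pi * real l / real p) * cos \<phi> * sqrt (1 - (cos \<phi>)\<^sup>2) + 1) ^ k)) / real p)"
proof -
  \<comment> \<open>This is the integrand at \<open>a = - \<theta>\<close>; the sign yields
    \<open>cos (\<theta> + b)\<close> and hence the negative sine term.\<close>
  define G where "G \<theta> b = (3 + 2 * cos \<theta> + 2 * cos b + 2 * cos (\<theta> + b)) ^ k" for \<theta> b :: real
  define A where "A \<theta> = integral {0..pi} (G \<theta>)" for \<theta>
  have G_cont: "continuous_on S (G \<theta>)" for S \<theta> unfolding G_def by (intro continuous_intros)
  have full: "integral {-pi..pi} (\<lambda>b. cmod (1 + cis b + cis (2 * pi * real l / real p - real 0 * b / real p)) ^ (2 * k))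
      = A (2 * pi * real l / real p) + A (- (2 * pi * real l / real p))" for l
  proof -
    let ?\<theta> = "2 * pi * real l / real p"
    have eq: "cmod (1 + cis b + cis (?\<theta> - real 0 * b / real p)) ^ (2 * k) = G (- ?\<theta>) b" for b
      by (simp add: power_mult cmod_sum3_cis G_def add.commute[of b] flip: cos_minus[of "_ - b"])
    have "G (- ?\<theta>) (- b) = G ?\<theta> b" for b
      using cos_minus[of "?\<theta> + b"] by (simp add: G_def)
    then show ?thesis
      unfolding eq using integral_symmetric_Icc[OF pi_ge_zero G_cont, of "- ?\<theta>"] by (simp add: A_def)
  qed
  \<comment> \<open>\<open>2 \<phi>\<close> covers only half of the circle; the other half is supplied by \<open>l \<mapsto> p - l\<close>.\<close>
  have reflect: "(\<Sum>l<p. A (- (2 * pi * real l / real p))) = (\<Sum>l<p. A (2 * pi * real l / real p))"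
  proof -
    define B where "B l = A (2 * pi * real l / real p)" for l :: nat
    have G_per: "G (\<theta> + 2 * pi) b = G \<theta> b" for \<theta> b
      using cos_periodic[of "\<theta> + b"] cos_periodic[of \<theta>] by (simp add: G_def add_ac mult.commute)
    \<comment> \<open>For \<open>l < p\<close> this index is \<open>p - l\<close>, written to fit
      \<open>sum.nat_diff_reindex\<close>. The indices then run over \<open>1..p\<close>, and
      \<open>B p = B 0\<close> moves them back to \<open>0..<p\<close>.\<close>
    have "A (- (2 * pi * real l / real p)) = B (Suc (p - Suc l))" if "l < p" for l
    proof -
      have "2 * pi * real (Suc (p - Suc l)) / real p = - (2 * pi * real l / real p) + 2 * pi"
        using that p by (simp add: of_nat_diff field_simps)
      then show ?thesis by (simp only: B_def A_def G_per[abs_def])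
    qed
    then have "(\<Sum>l<p. A (- (2 * pi * real l / real p))) = (\<Sum>l<p. B (Suc l))"
      using sum.nat_diff_reindex[of "\<lambda>l. B (Suc l)" p] by simp
    also have "B p = B 0"
      using G_per[of 0, abs_def] p by (simp add: B_def A_def)
    then have "(\<Sum>l<p. B (Suc l)) = (\<Sum>l<p. B l)"
      using sum.lessThan_Suc_shift[of B p] by simp
    finally show ?thesis unfolding B_def .
  qed
  have half: "integral {0..pi/2} (\<lambda>\<phi>. (4 * (1 + cos \<theta>) * (cos \<phi>)\<^sup>2 - 4 * sin \<theta> * cos \<phi> * sqrt (1 - (cos \<phi>)\<^sup>2) + 1) ^ k)
      = A \<theta> / 2" for \<theta>
  proof -
    have "(4 * (1 + cos \<theta>) * (cos \<phi>)\<^sup>2 - 4 * sin \<theta> * cos \<phi> * sqrt (1 - (cos \<phi>)\<^sup>2) + 1) ^ k = G \<theta> (2 * \<phi>)"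
      if "\<phi> \<in> {0..pi/2}" for \<phi>
    proof -
      have "sin \<phi> \<ge> 0" using that by (intro sin_ge_zero) auto
      then have "sqrt (1 - (cos \<phi>)\<^sup>2) = sin \<phi>" by (simp flip: sin_squared_eq)
      then show ?thesis
        unfolding G_def cos_add sin_double cos_double_cos by (simp add: algebra_simps)
    qed
    then have "integral {0..pi/2} (\<lambda>\<phi>. (4 * (1 + cos \<theta>) * (cos \<phi>)\<^sup>2 - 4 * sin \<theta> * cos \<phi> * sqrt (1 - (cos \<phi>)\<^sup>2) + 1) ^ k)
        = integral {0..pi/2} (\<lambda>\<phi>. G \<theta> (2 * \<phi>))"
      by (rule integral_cong)
    also have "(\<lambda>x. x / 2) ` {0..pi} = {0..pi/2}" by (simp add: image_divide_atLeastAtMost)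
    then have "integral {0..pi/2} (\<lambda>\<phi>. G \<theta> (2 * \<phi>)) = A \<theta> / 2"
      using integral_stretch_real[of 2 0 pi "G \<theta>"] by (simp add: A_def)
    finally show ?thesis .
  qed
  show ?thesis
    unfolding dual_nanotube_moment_eq[OF p] full sum.distrib reflect half
      sum_distrib_left[symmetric] sum_divide_distrib[symmetric]
    using p by (simp add: field_simps)
qed

text \<open>For \<open>q = p\<close> the nodes satisfy \<open>a + b = 2 * t\<close> with
  \<open>t = pi * l / p\<close>. Centring by \<open>b = t + u\<close>, \<open>a = t - u\<close>
  gives \<open>3 + 4 * cos t * cos u + 2 * cos (2 * u)\<close>, a quadratic in \<open>cos u\<close>;
  periodicity removes the shift by \<open>t\<close>.\<close>

lemma dual_nanotube_moment_armchair:
  assumes p: "p > 0"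
  shows "dual_nanotube_moment p p k = complex_of_real ((\<Sum>l<2*p. 2 / pi * integral {0..pi/2} (\<lambda>\<phi>.
    (4 * (cos \<phi>)\<^sup>2 + 4 * cos (pi * real l / real p) * cos \<phi> + 1) ^ k)) / real (2 * p))"
proof -
  define G where "G c \<phi> = (4 * (cos \<phi>)\<^sup>2 + 4 * c * cos \<phi> + 1) ^ k" for c \<phi> :: real
  define A where "A c = integral {0..pi/2} (G c)" for c
  have G_cont: "continuous_on S (G c)" for S c unfolding G_def by (intro continuous_intros)
  \<comment> \<open>Reflecting \<open>\<phi>\<close> to \<open>pi - \<phi>\<close> flips the sign of \<open>c\<close>, which is the shift \<open>l \<mapsto> p + l\<close>; this is why
    the uniform law on \<open>2 p\<close> points appears.\<close>
  have G_even: "G c (- b) = G c b" for c b by (simp add: G_def)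
  have full: "integral {-pi..pi} (\<lambda>b. cmod (1 + cis b + cis (2 * pi * real l / real p - real p * b / real p)) ^ (2 * k))
      = 2 * (A (cos (pi * real l / real p)) + A (cos (pi * real (p + l) / real p)))" for l
  proof -
    let ?t = "pi * real l / real p"
    have "cmod (1 + cis b + cis (2 * pi * real l / real p - real p * b / real p)) ^ (2 * k) = G (cos ?t) (b + - ?t)" for b
    proof -
      have "2 * pi * real l / real p - real p * b / real p = ?t - (b + - ?t)" using p by (simp add: field_simps)
      moreover have "3 + 2 * cos (?t - u) + 2 * cos (?t + u) + 2 * cos (?t - u - (?t + u))
          = 4 * (cos u)\<^sup>2 + 4 * cos ?t * cos u + 1" for u
        using cos_double_cos[of u] by (simp add: cos_add cos_diff)
      from this[of "b + - ?t"]
      have "(cmod (1 + cis b + cis (?t - (b + - ?t))))\<^sup>2 = 4 * (cos (b + - ?t))\<^sup>2 + 4 * cos ?t * cos (b + - ?t) + 1"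
        unfolding cmod_sum3_cis by simp
      ultimately show ?thesis by (simp add: power_mult G_def)
    qed
    then have "integral {-pi..pi} (\<lambda>b. cmod (1 + cis b + cis (2 * pi * real l / real p - real p * b / real p)) ^ (2 * k))
        = integral {-pi..pi} (G (cos ?t))"
      using integral_periodic_shift[OF G_cont, of "cos ?t" "- ?t"] by (simp add: G_def)
    also have "\<dots> = 2 * integral {0..pi} (G (cos ?t))"
      using integral_symmetric_Icc[OF pi_ge_zero G_cont, of "cos ?t"] G_even[of "cos ?t"] by simp
    also have "integral {0..pi} (G (cos ?t)) = integral {0..pi/2} (G (cos ?t)) + integral {pi/2..pi} (G (cos ?t))"
      by (intro Henstock_Kurzweil_Integration.integral_combine[symmetric] integrable_continuous_real G_cont) auto
    also have "integral {pi/2..pi} (G (cos ?t)) = integral {0..pi/2} (\<lambda>\<phi>. G (cos ?t) (pi - \<phi>))"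
      using Henstock_Kurzweil_Integration.integral_reflect_real[of pi "pi/2" "G (cos ?t)"]
        integral_shift_real_ivl[of "-pi" "-pi" "-(pi/2)" "\<lambda>\<phi>. G (cos ?t) (- \<phi>)"] by simp
    also have "(\<lambda>\<phi>. G (cos ?t) (pi - \<phi>)) = G (cos (pi * real (p + l) / real p))"
      using p by (simp add: G_def fun_eq_iff ring_distribs add_divide_distrib)
    finally show ?thesis unfolding A_def .
  qed
  have "(\<Sum>l<n. f l) + (\<Sum>l<m. f (n + l)) = (\<Sum>l<n+m. f l)" for f :: "nat \<Rightarrow> real" and n m
    by (induction m) auto
  from this[where n=p and m=p and f="\<lambda>l. A (cos (pi * real l / real p))"]
  have split: "(\<Sum>l<p. A (cos (pi * real l / real p)) + A (cos (pi * real (p + l) / real p)))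
      = (\<Sum>l<2*p. A (cos (pi * real l / real p)))"
    by (simp add: sum.distrib mult_2)
  show ?thesis
    unfolding dual_nanotube_moment_eq[OF p] full sum_distrib_left[symmetric] split
    unfolding A_def G_def by simp
qed

theorem corollary1:
  fixes M :: "'a measure" and V :: "'a \<Rightarrow> real"
  assumes "prob_space M"
    and "distributed M lborel V (\<lambda>x. ennreal (density_V x))"
  shows
    "(\<forall>(p :: nat) (J :: 'a \<Rightarrow> nat).
        (p, 0) \<in> NN \<longrightarrow>
        distr M (count_space UNIV) J = measure_pmf (pmf_of_set {0..<p}) \<longrightarrow>
        prob_space.indep_var M borel V borel (\<lambda>\<omega>. real (J \<omega>)) \<longrightarrow>
        dual_nanotube_law p 0 =
          distr M borel (\<lambda>\<omega>.
            4 * (1 + cos (2 * pi * real (J \<omega>) / real p)) * (V \<omega>)\<^sup>2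
            - 4 * sin (2 * pi * real (J \<omega>) / real p) * V \<omega> * sqrt (1 - (V \<omega>)\<^sup>2) + 1)) \<and>
     (\<forall>(p :: nat) (J :: 'a \<Rightarrow> nat).
        (p, p) \<in> NN \<longrightarrow>
        distr M (count_space UNIV) J = measure_pmf (pmf_of_set {0..<2 * p}) \<longrightarrow>
        prob_space.indep_var M borel V borel (\<lambda>\<omega>. real (J \<omega>)) \<longrightarrow>
        dual_nanotube_law p p =
          distr M borel (\<lambda>\<omega>.
            4 * (V \<omega>)\<^sup>2 + 4 * cos (pi * real (J \<omega>) / real p) * V \<omega> + 1))"
proof (intro conjI allI impI)
  interpret prob_space M by fact
  fix p :: nat and J :: "'a \<Rightarrow> nat"
  assume "(p, 0) \<in> NN" and J: "distr M (count_space UNIV) J = measure_pmf (pmf_of_set {0..<p})"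
    and indep: "indep_var borel V borel (\<lambda>\<omega>. real (J \<omega>))"
  then have p: "p > 0" by (simp add: NN_def)
  let ?g = "\<lambda>l v. 4 * (1 + cos (2 * pi * real l / real p)) * v\<^sup>2
    - 4 * sin (2 * pi * real l / real p) * v * sqrt (1 - v\<^sup>2) + 1"
  \<comment> \<open>\<open>sqrt\<close> is extended to negative arguments as an odd continuous
    function, so continuity holds also where \<open>v\<^sup>2 > 1\<close>.\<close>
  have "continuous_on UNIV (?g l)" for l by (intro continuous_intros)
  then show "dual_nanotube_law p 0 = distr M borel (\<lambda>\<omega>. ?g (J \<omega>) (V \<omega>))"
    by (rule dual_nanotube_law_mixture[OF assms(2) J p indep]) (rule dual_nanotube_moment_zigzag[OF p])
next
  interpret prob_space M by fact
  fix p :: nat and J :: "'a \<Rightarrow> nat"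
  assume "(p, p) \<in> NN" and J: "distr M (count_space UNIV) J = measure_pmf (pmf_of_set {0..<2 * p})"
    and indep: "indep_var borel V borel (\<lambda>\<omega>. real (J \<omega>))"
  then have p: "p > 0" and p2: "2 * p > 0" by (auto simp: NN_def)
  let ?g = "\<lambda>l v. 4 * v\<^sup>2 + 4 * cos (pi * real l / real p) * v + 1"
  have "continuous_on UNIV (?g l)" for l by (intro continuous_intros)
  then show "dual_nanotube_law p p = distr M borel (\<lambda>\<omega>. ?g (J \<omega>) (V \<omega>))"
    by (rule dual_nanotube_law_mixture[OF assms(2) J p2 indep]) (rule dual_nanotube_moment_armchair[OF p])
qed

end
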